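(* Let $\gamma_n$ be the minimum of $\lambda_1(G)-\lambda_2(G)$ over all connected simple graphs $G$ on $n$ vertices. Then, as $n\to\infty$, $$\gamma_n\le\exp\{-n\log n+n\log\log n+O(n)\}.$$ In particular, $\gamma_n=o(n^{-K})$ for every fixed $K>0$.
   Context: $\lambda_1(G)\ge\lambda_2(G)\ge\cdots$ denote the adjacency eigenvalues of $G$ with multiplicity. Logarithms are natural. *)

theory Defs
  imports
    "Jordan_Normal_Form.Char_Poly"
    "Graph_Theory.Pair_Digraph"
    "Graph_Theory.Digraph_Component"
    "HOL-Library.Landau_Symbols"
begin

text \<open>
  A simple graph is a \<^const>\<open>pair_graph\<close>: a finite, loop-free digraph without parallel
  arcs whose arc relation is symmetric. As isomorphic graphs have the same adjacency eigenvalues,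
  the graphs on \<open>n\<close> vertices are taken on the vertex set \<open>{..<n}\<close>, so that they form a finite set.
\<close>

definition connected_graphs :: "nat \<Rightarrow> nat pair_pre_digraph set" where
  "connected_graphs n =
     {G. pair_graph G \<and> pverts G = {..<n} \<and> Digraph_Component.connected (with_proj G)}"

definition adjacency_matrix :: "nat pair_pre_digraph \<Rightarrow> real mat" where
  "adjacency_matrix G =
     mat (card (pverts G)) (card (pverts G)) (\<lambda>(i, j). if (i, j) \<in> parcs G then 1 else 0)"

text \<open>
  The \<open>k\<close>-th largest adjacency eigenvalue (\<open>1 \<le> k \<le> n\<close>), counted with multiplicity. For a graph on
  \<open>{..<n}\<close> the matrix is real symmetric, so its characteristic polynomial has \<open>n\<close> real roots and
  the list below has length \<open>n\<close>.
\<close>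

definition adjacency_eigenvalue :: "nat pair_pre_digraph \<Rightarrow> nat \<Rightarrow> real" where
  "adjacency_eigenvalue G k =
     rev (sorted_list_of_multiset (proots (char_poly (adjacency_matrix G)))) ! (k - 1)"

definition min_spectral_gap :: "nat \<Rightarrow> real" where
  "min_spectral_gap n =
     Min ((\<lambda>G. adjacency_eigenvalue G 1 - adjacency_eigenvalue G 2) ` connected_graphs n)"

text \<open>The minimum is over a finite set, nonempty for \<open>n \<ge> 1\<close>.\<close>

lemma finite_connected_graphs: "finite (connected_graphs n)"
proof (rule finite_subset)
  show "connected_graphs n \<subseteq>
      (\<lambda>E. \<lparr>pverts = {..<n}, parcs = E\<rparr>) ` Pow ({..<n} \<times> {..<n})"
  proof
    fix G assume G: "G \<in> connected_graphs n"
    then interpret pair_graph G by (simp add: connected_graphs_def)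
    have "parcs G \<subseteq> {..<n} \<times> {..<n}"
      using G in_arcsD1 in_arcsD2 by (auto simp: connected_graphs_def)
    moreover have "G = \<lparr>pverts = {..<n}, parcs = parcs G\<rparr>"
      using G by (simp add: connected_graphs_def)
    ultimately show "G \<in> (\<lambda>E. \<lparr>pverts = {..<n}, parcs = E\<rparr>) ` Pow ({..<n} \<times> {..<n})"
      by blast
  qed
qed simp

lemma connected_graphs_nonempty:
  assumes "n \<ge> 1"
  shows "connected_graphs n \<noteq> {}"
proof -
  define K :: "nat pair_pre_digraph" where
    "K = \<lparr>pverts = {..<n}, parcs = {(i, j). i < n \<and> j < n \<and> i \<noteq> j}\<rparr>"
  have "parcs K \<subseteq> {..<n} \<times> {..<n}"
    by (auto simp: K_def)
  then have "finite (parcs K)"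
    by (rule finite_subset) simp
  then have K: "pair_graph K"
    by unfold_locales (auto simp: K_def symmetric_def sym_def)
  interpret pair_graph K by (rule K)
  have "u \<rightarrow>\<^sup>*\<^bsub>with_proj K\<^esub> v" if "u < n" "v < n" for u v
  proof (cases "u = v")
    case True
    with that show ?thesis using reachable_refl[of u] by (simp add: K_def)
  next
    case False
    with that have "(u, v) \<in> parcs K" by (simp add: K_def)
    then show ?thesis using reachable_adjI[of u v] by simp
  qed
  then have "Digraph_Component.connected (with_proj K)"
    using assms reachable_mk_symmetricI
    by (auto simp: connected_def strongly_connected_def K_def lessThan_empty_iff)
  with K have "K \<in> connected_graphs n"
    by (simp add: connected_graphs_def K_def)
  then show ?thesis by blast
qed

end

theory Submission
  imports Defs "HOL-Real_Asymp.Real_Asymp"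
begin

text \<open>
  Double kites have a tiny spectral gap. They consist of two cliques on \<open>p + 1\<close> vertices
  joined by a path with \<open>L\<close> edges, so that there are \<open>n = 2 * p + L + 1\<close> vertices. Each clique alone has an eigenvalue close
  to \<open>p\<close>, and the two copies interact only through the path. An eigenvector decays along the path by
  a factor \<open>t \<approx> p\<close> per edge, so the interaction separates the two copies of the eigenvalue only by
  about \<open>t ^ (- L)\<close>.

  To make this exact, write an eigenvalue as \<open>t + 1 / t\<close>. On the path the eigenvalue equation is
  the recurrence with solutions \<open>t ^ j\<close> and \<open>t ^ (- j)\<close>, and the reflection symmetry of the graph
  singles out an even solution (sign \<open>s = 1\<close>) and an odd one (\<open>s = - 1\<close>). What remains is one scalar
  equation matching the path to the cliques (\<open>kite_equation\<close>), which has a root in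
  \<open>[p - 1, p]\<close> for either sign by the intermediate value theorem. The even eigenvector is positive,
  so by the Perron-Frobenius argument its eigenvalue is the largest one; the odd eigenvalue is
  a different one and hence bounds the second largest from below. Comparing the two scalar
  equations gives
  \<open>\<lambda>\<^sub>1 - \<lambda>\<^sub>2 \<le> 2 * p / (p - 1) ^ (L + 1)\<close> (lemma \<open>double_kite_gap\<close>).

  With \<open>p \<approx> n / ln n\<close> the cliques use only \<open>O(n / ln n)\<close> vertices, which cost
  \<open>O(n / ln n) * ln p = O(n)\<close> in the exponent, while
  \<open>n * ln p = n * ln n - n * ln (ln n) + O(n)\<close>. This is the claimed bound. The \<open>o\<close>-statement compares
  absolute values and therefore also uses that the gap is nonnegative, that is, that the list of
  eigenvalues really has at least two entries: the characteristic polynomial of a real symmetric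
  matrix splits over the reals.
\<close>

section \<open>Eigenvalues of real symmetric matrices\<close>

lemma root_char_poly_mat_iff:
  fixes f :: "nat \<times> nat \<Rightarrow> 'a :: field"
  shows "poly (char_poly (mat n n f)) \<mu> = 0 \<longleftrightarrow>
    (\<exists>w. (\<exists>i<n. w i \<noteq> 0) \<and> (\<forall>i<n. (\<Sum>j<n. f (i, j) * w j) = \<mu> * w i))"
proof -
  let ?A = "mat n n f"
  have "poly (char_poly ?A) \<mu> = 0 \<longleftrightarrow> (\<exists>v. eigenvector ?A v \<mu>)"
    using eigenvalue_root_char_poly[of ?A n \<mu>] by (simp add: eigenvalue_def)
  also have "\<dots> \<longleftrightarrow>
    (\<exists>w. (\<exists>i<n. w i \<noteq> 0) \<and> (\<forall>i<n. (\<Sum>j<n. f (i, j) * w j) = \<mu> * w i))"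
  proof
    assume "\<exists>v. eigenvector ?A v \<mu>"
    then obtain v where "eigenvector ?A v \<mu>" by blast
    then have v: "dim_vec v = n" "v \<noteq> 0\<^sub>v n" "?A *\<^sub>v v = \<mu> \<cdot>\<^sub>v v"
      by (auto simp: eigenvector_def)
    have "(\<Sum>j<n. f (i, j) * v $ j) = \<mu> * v $ i" if "i < n" for i
      using arg_cong[OF v(3), of "\<lambda>u. u $ i"] that v(1)
      by (simp add: scalar_prod_def atLeast0LessThan)
    moreover have "\<exists>i<n. v $ i \<noteq> 0"
      using v(1,2) by (auto intro!: eq_vecI)
    ultimately show "\<exists>w. (\<exists>i<n. w i \<noteq> 0) \<and> (\<forall>i<n. (\<Sum>j<n. f (i, j) * w j) = \<mu> * w i)"
      by blast
  next
    assume "\<exists>w. (\<exists>i<n. w i \<noteq> 0) \<and> (\<forall>i<n. (\<Sum>j<n. f (i, j) * w j) = \<mu> * w i)"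
    then obtain w i where w: "i < n" "w i \<noteq> 0"
      "\<And>i. i < n \<Longrightarrow> (\<Sum>j<n. f (i, j) * w j) = \<mu> * w i" by blast
    have "vec n w \<noteq> 0\<^sub>v n"
    proof
      assume "vec n w = 0\<^sub>v n"
      then have "vec n w $ i = 0\<^sub>v n $ i" by simp
      with w(1,2) show False by simp
    qed
    moreover have "?A *\<^sub>v vec n w = \<mu> \<cdot>\<^sub>v vec n w"
      using w(3) by (intro eq_vecI) (simp_all add: scalar_prod_def atLeast0LessThan)
    ultimately have "eigenvector ?A (vec n w) \<mu>"
      by (simp add: eigenvector_def)
    then show "\<exists>v. eigenvector ?A v \<mu>" ..
  qed
  finally show ?thesis .
qed

text \<open>
  The Hermitian form \<open>w\<^sup>* A w\<close> of an eigenvector is on the one hand its own conjugate,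
  on the other hand the eigenvalue times the squared norm of \<open>w\<close>.
\<close>

lemma symmetric_complex_eigenvalue_real:
  fixes f :: "nat \<times> nat \<Rightarrow> real"
  assumes sym: "\<And>i j. i < n \<Longrightarrow> j < n \<Longrightarrow> f (i, j) = f (j, i)"
    and root: "poly (char_poly (mat n n (\<lambda>x. complex_of_real (f x)))) a = 0"
  shows "a \<in> \<real>"
proof -
  obtain w i where w: "i < n" "w i \<noteq> 0"
    "\<And>i. i < n \<Longrightarrow> (\<Sum>j<n. of_real (f (i, j)) * w j) = a * w i"
    using root unfolding root_char_poly_mat_iff by blast
  define S where "S = (\<Sum>i<n. \<Sum>j<n. of_real (f (i, j)) * cnj (w i) * w j)"
  define N where "N = (\<Sum>i<n. (cmod (w i))\<^sup>2)"
  have "cnj S = (\<Sum>i<n. \<Sum>j<n. of_real (f (i, j)) * w i * cnj (w j))"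
    by (simp add: S_def)
  also have "\<dots> = (\<Sum>j<n. \<Sum>i<n. of_real (f (i, j)) * w i * cnj (w j))"
    by (rule sum.swap)
  also have "\<dots> = S"
    unfolding S_def using sym by (intro sum.cong) (auto simp: mult_ac)
  finally have "S \<in> \<real>" by (simp add: Reals_cnj_iff)
  have "S = (\<Sum>i<n. cnj (w i) * (\<Sum>j<n. of_real (f (i, j)) * w j))"
    by (simp add: S_def sum_distrib_left mult_ac)
  also have "\<dots> = (\<Sum>i<n. cnj (w i) * (a * w i))"
    using w(3) by simp
  also have "\<dots> = a * of_real N"
    by (simp add: N_def sum_distrib_left mult_ac complex_norm_square del: of_real_power)
  finally have "S = a * of_real N" .
  moreover have "N > 0"
    unfolding N_def using w(1,2) by (intro sum_pos2[of _ i]) auto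
  ultimately have "a = S / of_real N" by simp
  with \<open>S \<in> \<real>\<close> show ?thesis by simp
qed

text \<open>
  Over the complex numbers the characteristic polynomial is a product of linear factors. Their roots
  are real, so the factorization is the image of one over the reals.
\<close>

lemma symmetric_char_poly_splits:
  fixes f :: "nat \<times> nat \<Rightarrow> real"
  assumes sym: "\<And>i j. i < n \<Longrightarrow> j < n \<Longrightarrow> f (i, j) = f (j, i)"
  shows "size (proots (char_poly (mat n n f))) = n"
proof -
  let ?C = "mat n n (\<lambda>x. complex_of_real (f x))"
  interpret cplx_poly: map_poly_inj_comm_ring_hom complex_of_real ..
  obtain as where as: "char_poly ?C = (\<Prod>a\<leftarrow>as. [:- a, 1:])" "length as = n"
    using char_poly_factorized[of ?C n] by auto
  have "poly (char_poly ?C) a = 0" if "a \<in> set as" for a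
    using that unfolding as(1) by (simp add: poly_prod_list prod_list_zero_iff image_iff)
  then have "set as \<subseteq> \<real>"
    using symmetric_complex_eigenvalue_real[of n f, OF sym] by blast
  then obtain bs where bs: "as = map complex_of_real bs"
    unfolding Reals_def using ex_map_conv[of as complex_of_real] by blast
  have "map_poly complex_of_real (char_poly (mat n n f))
      = char_poly (map_mat complex_of_real (mat n n f))"
    by (rule of_real_hom.char_poly_hom[symmetric]) auto
  also have "map_mat complex_of_real (mat n n f) = ?C"
    by (intro eq_matI) auto
  also have "char_poly ?C = map_poly complex_of_real (\<Prod>b\<leftarrow>bs. [:- b, 1:])"
    unfolding as(1) bs by (simp add: cplx_poly.hom_prod_list o_def)
  finally have "char_poly (mat n n f) = (\<Prod>b\<leftarrow>bs. [:- b, 1:])"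
    by simp
  moreover have "size (proots (\<Prod>b\<leftarrow>bs. [:- b, 1:])) = length bs"
  proof (induction bs)
    case (Cons b bs)
    have "(\<Prod>b\<leftarrow>bs. [:- b, 1:]) \<noteq> 0" by (auto simp: prod_list_zero_iff)
    then have "proots ([:- b, 1:] * (\<Prod>b\<leftarrow>bs. [:- b, 1:]))
        = proots [:- b, 1:] + proots (\<Prod>b\<leftarrow>bs. [:- b, 1:])"
      by (intro proots_mult) auto
    then show ?case using Cons.IH by (simp del: mult_pCons_left)
  qed simp
  ultimately show ?thesis using as(2) bs by simp
qed

text \<open>
  The elementary half of the Perron-Frobenius theorem: a positive eigenvector belongs to the largest
  eigenvalue. Scale an arbitrary eigenvector \<open>w\<close> so that it lies below the positive one in absolute
  value and touches it at a coordinate \<open>m\<close>; then row \<open>m\<close> compares the two eigenvalues.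
\<close>

lemma nonneg_matrix_eigenvalue_le:
  fixes f :: "nat \<times> nat \<Rightarrow> real"
  assumes nonneg: "\<And>i j. i < n \<Longrightarrow> j < n \<Longrightarrow> f (i, j) \<ge> 0"
    and pos: "\<And>i. i < n \<Longrightarrow> v i > 0"
    and v: "\<And>i. i < n \<Longrightarrow> (\<Sum>j<n. f (i, j) * v j) = r * v i"
    and root: "poly (char_poly (mat n n f)) \<mu> = 0"
  shows "\<mu> \<le> r"
proof -
  obtain w i where w: "i < n" "w i \<noteq> 0"
    "\<And>i. i < n \<Longrightarrow> (\<Sum>j<n. f (i, j) * w j) = \<mu> * w i"
    using root unfolding root_char_poly_mat_iff by blast
  define M where "M = Max ((\<lambda>i. \<bar>w i\<bar> / v i) ` {..<n})"
  have "M \<in> (\<lambda>i. \<bar>w i\<bar> / v i) ` {..<n}"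
    unfolding M_def using w(1) by (intro Max_in) auto
  then obtain m where m: "m < n" "M = \<bar>w m\<bar> / v m" by auto
  have le: "\<bar>w j\<bar> \<le> M * v j" if "j < n" for j
  proof -
    have "\<bar>w j\<bar> / v j \<le> M" unfolding M_def using that by (intro Max_ge) auto
    then show ?thesis using pos[OF that] by (simp add: divide_le_eq)
  qed
  have "0 < \<bar>w i\<bar>" using w(2) by simp
  also have "\<dots> \<le> M * v i" using le w(1) .
  finally have "M > 0" using pos[OF w(1)] by (simp add: zero_less_mult_iff)
  have "\<mu> * (M * v m) = \<mu> * \<bar>w m\<bar>" using m pos[OF m(1)] by simp
  also have "\<dots> \<le> \<bar>\<mu> * w m\<bar>" by (simp add: abs_mult mult_right_mono)
  also have "\<dots> = \<bar>\<Sum>j<n. f (m, j) * w j\<bar>" using w(3)[OF m(1)] by simp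
  also have "\<dots> \<le> (\<Sum>j<n. f (m, j) * \<bar>w j\<bar>)"
    using nonneg m(1) by (intro order.trans[OF sum_abs] sum_mono) (simp add: abs_mult)
  also have "\<dots> \<le> (\<Sum>j<n. f (m, j) * (M * v j))"
    using nonneg m(1) le by (intro sum_mono mult_left_mono) auto
  also have "\<dots> = M * (\<Sum>j<n. f (m, j) * v j)"
    by (simp add: sum_distrib_left mult_ac)
  also have "\<dots> = r * (M * v m)" using v[OF m(1)] by simp
  finally show ?thesis
    using \<open>M > 0\<close> pos[OF m(1)] by (simp add: mult_le_cancel_right)
qed

section \<open>The two largest adjacency eigenvalues\<close>

lemma adjacency_matrix_connected_graph:
  assumes "G \<in> connected_graphs n"
  shows "adjacency_matrix G = mat n n (\<lambda>(i, j). if (i, j) \<in> parcs G then 1 else 0)"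
  using assms by (simp add: adjacency_matrix_def connected_graphs_def)

lemma size_adjacency_spectrum:
  assumes "G \<in> connected_graphs n"
  shows "size (proots (char_poly (adjacency_matrix G))) = n"
proof -
  interpret pair_graph G using assms by (simp add: connected_graphs_def)
  have "(i, j) \<in> parcs G \<longleftrightarrow> (j, i) \<in> parcs G" for i j
    using arcs_symmetric by blast
  then show ?thesis
    unfolding adjacency_matrix_connected_graph[OF assms]
    by (intro symmetric_char_poly_splits) auto
qed

text \<open>
  The bound \<open>l \<le> n\<close> keeps the index inside the list of eigenvalues: beyond its end, list access
  yields unspecified values. This is where the splitting of the characteristic polynomial enters.
\<close>

lemma adjacency_eigenvalue_antimono:
  assumes "G \<in> connected_graphs n" "1 \<le> k" "k \<le> l" "l \<le> n"
  shows "adjacency_eigenvalue G l \<le> adjacency_eigenvalue G k"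
  unfolding adjacency_eigenvalue_def
  using assms sorted_rev_nth_mono[of
      "rev (sorted_list_of_multiset (proots (char_poly (adjacency_matrix G))))" "k - 1" "l - 1"]
    size_adjacency_spectrum[OF assms(1)]
  by (simp flip: size_mset)

text \<open>
  The eigenvalues are given by sorting a multiset; to bound the gap it suffices to exhibit the
  largest eigenvalue and any other eigenvalue, without knowing the rest of the spectrum.
\<close>

lemma spectral_gap_le_difference:
  assumes G: "G \<in> connected_graphs n"
    and root: "poly (char_poly (adjacency_matrix G)) b = 0"
    and max: "\<And>x. poly (char_poly (adjacency_matrix G)) x = 0 \<Longrightarrow> x \<le> a"
    and "poly (char_poly (adjacency_matrix G)) a = 0" "a \<noteq> b"
  shows "adjacency_eigenvalue G 1 - adjacency_eigenvalue G 2 \<le> a - b"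
proof -
  define p where "p = char_poly (adjacency_matrix G)"
  define xs where "xs = rev (sorted_list_of_multiset (proots p))"
  have "p \<noteq> 0"
    using degree_monic_char_poly[of "adjacency_matrix G" n] adjacency_matrix_connected_graph[OF G]
    by (auto simp: p_def)
  then have set: "set xs = {x. poly p x = 0}" by (simp add: xs_def)
  have sorted: "sorted (rev xs)" by (simp add: xs_def)
  have "a \<in> set xs" "b \<in> set xs" using assms(4) root by (simp_all add: set p_def)
  then obtain i j where ij: "i < length xs" "xs ! i = a" "j < length xs" "xs ! j = b"
    unfolding in_set_conv_nth by blast
  have 0: "xs ! 0 = a"
  proof (rule antisym)
    have "xs ! 0 \<in> set xs" using ij(1) by (intro nth_mem) auto
    then show "xs ! 0 \<le> a" using set max by (auto simp: p_def)
    show "a \<le> xs ! 0" using sorted_rev_nth_mono[OF sorted, of 0 i] ij by simp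
  qed
  with ij(4) assms(5) have "j \<noteq> 0" by metis
  then have "b \<le> xs ! 1" using sorted_rev_nth_mono[OF sorted, of 1 j] ij by simp
  then show ?thesis using 0 by (simp add: adjacency_eigenvalue_def xs_def p_def)
qed

lemma min_spectral_gap_nonneg:
  assumes "n \<ge> 2"
  shows "min_spectral_gap n \<ge> 0"
  unfolding min_spectral_gap_def
  using assms finite_connected_graphs connected_graphs_nonempty[of n]
    adjacency_eigenvalue_antimono[of _ n 1 2]
  by (subst Min_ge_iff) auto

lemma min_spectral_gap_le:
  assumes "G \<in> connected_graphs n"
  shows "min_spectral_gap n \<le> adjacency_eigenvalue G 1 - adjacency_eigenvalue G 2"
  unfolding min_spectral_gap_def using assms finite_connected_graphs by (intro Min_le) auto

section \<open>Double kites\<close>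

text \<open>
  The vertices are numbered along the graph: \<open>{0..p}\<close> is the first clique, \<open>{p..p + L}\<close> the path,
  whose ends belong to the cliques, and \<open>{p + L..2 * p + L}\<close> the second clique. In this numbering
  consecutive vertices are always adjacent, and \<open>i \<mapsto> 2 * p + L - i\<close> is an automorphism.
\<close>

definition double_kite :: "nat \<Rightarrow> nat \<Rightarrow> nat pair_pre_digraph" where
  "double_kite p L = \<lparr>pverts = {..<2 * p + L + 1},
     parcs = {(i, j). i < 2 * p + L + 1 \<and> j < 2 * p + L + 1 \<and> i \<noteq> j \<and>
       (i = Suc j \<or> j = Suc i \<or> i \<le> p \<and> j \<le> p \<or> p + L \<le> i \<and> p + L \<le> j)}\<rparr>"

lemma double_kite_connected: "double_kite p L \<in> connected_graphs (2 * p + L + 1)"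
proof -
  let ?K = "double_kite p L" and ?n = "2 * p + L + 1"
  have "parcs ?K \<subseteq> {..<?n} \<times> {..<?n}"
    by (auto simp: double_kite_def)
  then have "finite (parcs ?K)"
    by (rule finite_subset) simp
  then have K: "pair_graph ?K"
    by unfold_locales (auto simp: double_kite_def symmetric_def sym_def)
  interpret pair_graph ?K by (rule K)
  have "0 \<rightarrow>\<^sup>*\<^bsub>with_proj ?K\<^esub> v" if "v < ?n" for v
    using that
  proof (induction v)
    case 0
    then show ?case using reachable_refl[of 0] by (simp add: double_kite_def)
  next
    case (Suc v)
    then have "(v, Suc v) \<in> parcs ?K" by (simp add: double_kite_def)
    then have "v \<rightarrow>\<^sup>*\<^bsub>with_proj ?K\<^esub> Suc v"
      using reachable_adjI[of v "Suc v"] by simp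
    moreover have "0 \<rightarrow>\<^sup>*\<^bsub>with_proj ?K\<^esub> v" using Suc by simp
    ultimately show ?case by (blast intro: reachable_trans)
  qed
  moreover have "v \<rightarrow>\<^sup>*\<^bsub>with_proj ?K\<^esub> 0" if "v < ?n" for v
    using that
  proof (induction v)
    case 0
    then show ?case using reachable_refl[of 0] by (simp add: double_kite_def)
  next
    case (Suc v)
    then have "(Suc v, v) \<in> parcs ?K" by (simp add: double_kite_def)
    then have "Suc v \<rightarrow>\<^sup>*\<^bsub>with_proj ?K\<^esub> v"
      using reachable_adjI[of "Suc v" v] by simp
    moreover have "v \<rightarrow>\<^sup>*\<^bsub>with_proj ?K\<^esub> 0" using Suc by simp
    ultimately show ?case by (blast intro: reachable_trans)
  qed
  ultimately have "u \<rightarrow>\<^sup>*\<^bsub>with_proj ?K\<^esub> v" if "u < ?n" "v < ?n" for u v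
    using that reachable_trans by blast
  then have "Digraph_Component.connected (with_proj ?K)"
    using reachable_mk_symmetricI
    by (auto simp: connected_def strongly_connected_def double_kite_def lessThan_empty_iff)
  with K show ?thesis
    by (simp add: connected_graphs_def double_kite_def)
qed

text \<open>
  The ansatz for an eigenvector with eigenvalue \<open>t + 1 / t\<close>, even under reflection for \<open>s = 1\<close> and odd
  for \<open>s = - 1\<close>. On the path, at distance \<open>j\<close> from its first end, it is \<open>t ^ (L - j) + s * t ^ j\<close>.
  The recurrence on the path would extend this to \<open>t ^ (L + 1) + s / t\<close> at distance \<open>- 1\<close>;
  this is the total weight that the \<open>p\<close> clique neighbours of the end vertex must have, and they
  share it equally.
\<close>

definition kite_vector :: "nat \<Rightarrow> nat \<Rightarrow> real \<Rightarrow> real \<Rightarrow> nat \<Rightarrow> real" where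
  "kite_vector p L s t i =
     (if i < p then (t ^ (L + 1) + s / t) / p
      else if i \<le> p + L then t ^ (p + L - i) + s * t ^ (i - p)
      else s * ((t ^ (L + 1) + s / t) / p))"

text \<open>
  The eigenvalue equation at the vertices of the clique that are not on the path, multiplied by \<open>p\<close>;
  all the other equations hold by the choice of \<open>kite_vector\<close>.
\<close>

definition kite_equation :: "nat \<Rightarrow> nat \<Rightarrow> real \<Rightarrow> real \<Rightarrow> bool" where
  "kite_equation p L s t \<longleftrightarrow>
     (t + 1 / t - (real p - 1)) * (t ^ (L + 1) + s / t) = p * (t ^ L + s)"

lemma double_kite_row_sum:
  assumes "i < 2 * p + L + 1"
  shows "(\<Sum>j<2 * p + L + 1. (if (i, j) \<in> parcs (double_kite p L) then 1 else 0) * v j)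
    = (\<Sum>j | (i, j) \<in> parcs (double_kite p L). v j :: real)"
proof -
  have "{j. (i, j) \<in> parcs (double_kite p L)} \<subseteq> {..<2 * p + L + 1}"
    by (auto simp: double_kite_def)
  then show ?thesis
    by (intro sum.mono_neutral_cong_right) auto
qed

lemma kite_vector_reflect:
  assumes "s * s = 1" "i < 2 * p + L + 1"
  shows "kite_vector p L s t (2 * p + L - i) = s * kite_vector p L s t i"
proof -
  have s: "s * (s * x) = x" for x using assms(1) by (metis mult.assoc mult_1)
  consider "i < p" | "p \<le> i" "i \<le> p + L" | "p + L < i" by linarith
  then show ?thesis
  proof cases
    case 2
    then have "p + L - (2 * p + L - i) = i - p" "2 * p + L - i - p = p + L - i" by auto
    with 2 show ?thesis by (auto simp: kite_vector_def s distrib_left)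
  qed (use assms in \<open>auto simp: kite_vector_def s\<close>)
qed

lemma double_kite_neighbours_reflect:
  assumes "i < 2 * p + L + 1"
  shows "{j. (2 * p + L - i, j) \<in> parcs (double_kite p L)}
     = (\<lambda>j. 2 * p + L - j) ` {j. (i, j) \<in> parcs (double_kite p L)}"
proof -
  have *: "(2 * p + L - i, 2 * p + L - j) \<in> parcs (double_kite p L)"
    if "(i, j) \<in> parcs (double_kite p L)" for i j
    using that by (auto simp: double_kite_def)
  show ?thesis
  proof (intro equalityI subsetI)
    fix j assume j: "j \<in> {j. (2 * p + L - i, j) \<in> parcs (double_kite p L)}"
    then have "j \<le> 2 * p + L" by (simp add: double_kite_def)
    moreover have "(i, 2 * p + L - j) \<in> parcs (double_kite p L)"
      using *[of "2 * p + L - i" j] j assms by simp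
    ultimately show "j \<in> (\<lambda>j. 2 * p + L - j) ` {j. (i, j) \<in> parcs (double_kite p L)}"
      by (intro image_eqI[of _ _ "2 * p + L - j"]) auto
  qed (use * in auto)
qed

text \<open>
  The bound on \<open>i\<close> leaves out the second clique with its end of the path, which is the mirror
  image of the first one. With \<open>L \<ge> 2\<close> the inner neighbour of the end \<open>p\<close> of the path is still an
  inner vertex, so that the cliques do not see each other.
\<close>

lemma kite_vector_eigen_left:
  assumes "p \<ge> 1" "L \<ge> 2" "t > 0" "kite_equation p L s t" "i < p + L"
  shows "(\<Sum>j | (i, j) \<in> parcs (double_kite p L). kite_vector p L s t j)
    = (t + 1 / t) * kite_vector p L s t i"
proof -
  let ?N = "{j. (i, j) \<in> parcs (double_kite p L)}" and ?v = "kite_vector p L s t"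
  define c where "c = (t ^ (L + 1) + s / t) / p"
  have pc: "p * c = t ^ (L + 1) + s / t" using assms(1) by (simp add: c_def)
  have v_clique: "?v j = c" if "j < p" for j using that by (simp add: kite_vector_def c_def)
  have v_path: "?v (p + k) = t ^ (L - k) + s * t ^ k" if "k \<le> L" for k
    using that by (simp add: kite_vector_def)
  have v_p: "?v p = t ^ L + s" using v_path[of 0] by simp
  consider "i < p" | "i = p" | "p < i" by linarith
  then show ?thesis
  proof cases
    case 1
    then have N: "?N = insert p ({..<p} - {i})"
      using assms(2) by (auto simp: double_kite_def)
    have "p * ((t + 1 / t - (real p - 1)) * c) = (t + 1 / t - (real p - 1)) * (p * c)"
      by (rule mult.left_commute)
    also have "\<dots> = p * (t ^ L + s)"
      unfolding pc using assms(4) by (simp only: kite_equation_def)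
    finally have "p * ((t + 1 / t - (real p - 1)) * c) = p * (t ^ L + s)" .
    then have eq: "(t + 1 / t - (real p - 1)) * c = t ^ L + s" using assms(1) by simp
    have "sum ?v ({..<p} - {i}) = sum (\<lambda>_. c) ({..<p} - {i})"
      using v_clique by (intro sum.cong) auto
    also have "\<dots> = (real p - 1) * c"
      using 1 by (simp add: of_nat_diff)
    finally have "sum ?v ?N = t ^ L + s + (real p - 1) * c"
      using N v_p by simp
    also have "\<dots> = (t + 1 / t) * c"
      unfolding eq[symmetric] by (simp only: left_diff_distrib diff_add_cancel)
    finally show ?thesis using v_clique[OF 1] by simp
  next
    case 2
    then have N: "?N = insert (p + 1) {..<p}"
      using assms(2) by (auto simp: double_kite_def)
    define x where "x = t ^ (L - 1)"
    have x: "t ^ L = t * x" using assms(2) unfolding x_def by (simp flip: power_Suc)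
    have "sum ?v {..<p} = sum (\<lambda>_. c) {..<p}"
      using v_clique by (intro sum.cong) auto
    then have "sum ?v ?N = x + s * t + p * c"
      unfolding N x_def using v_path[of 1] assms(2) by simp
    also have "\<dots> = x + s * t + (t * (t * x) + s / t)"
      unfolding pc by (simp add: x)
    also have "\<dots> = (t + 1 / t) * (t * x + s)"
      using assms(3) by (simp add: field_simps)
    finally show ?thesis using 2 v_p x by simp
  next
    case 3
    define k where "k = i - p"
    have k: "i = p + k" "0 < k" "k < L" using 3 assms(5) by (auto simp: k_def)
    then have N: "?N = {p + (k - 1), p + (k + 1)}"
      by (auto simp: double_kite_def)
    define x y where "x = t ^ (L - (k + 1))" and "y = t ^ (k - 1)"
    have "L - k = Suc (L - (k + 1))" "L - (k - 1) = Suc (Suc (L - (k + 1)))"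
      "k = Suc (k - 1)" "k + 1 = Suc (Suc (k - 1))"
      using k(2,3) by linarith+
    then have pows: "t ^ (L - k) = t * x" "t ^ (L - (k - 1)) = t * (t * x)"
      "t ^ k = t * y" "t ^ (k + 1) = t * (t * y)"
      unfolding x_def y_def by (metis power_Suc)+
    have "?v (p + (k - 1)) = t * (t * x) + s * y" "?v (p + (k + 1)) = x + s * (t * (t * y))"
      using v_path[of "k - 1"] v_path[of "k + 1"] k(3) pows(2,4)
      by (simp_all add: x_def y_def)
    then have "sum ?v ?N = t * (t * x) + s * y + (x + s * (t * (t * y)))"
      unfolding N by simp
    also have "\<dots> = (t + 1 / t) * (t * x + s * (t * y))"
      using assms(3) by (simp add: field_simps)
    finally show ?thesis using v_path[of k] k(1,3) pows(1,3) by simp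
  qed
qed

lemma kite_vector_eigen:
  assumes "p \<ge> 1" "L \<ge> 2" "t > 0" "kite_equation p L s t" "s * s = 1" "i < 2 * p + L + 1"
  shows "(\<Sum>j<2 * p + L + 1.
      (if (i, j) \<in> parcs (double_kite p L) then 1 else 0) * kite_vector p L s t j)
    = (t + 1 / t) * kite_vector p L s t i"
proof (cases "i < p + L")
  case True
  then show ?thesis
    using assms double_kite_row_sum kite_vector_eigen_left by simp
next
  case False
  let ?E = "parcs (double_kite p L)" and ?v = "kite_vector p L s t"
  define i' where "i' = 2 * p + L - i"
  have i': "i' < p + L" "i' < 2 * p + L + 1" "2 * p + L - i' = i"
    using False assms by (auto simp: i'_def)
  have "inj_on (\<lambda>j. 2 * p + L - j) {j. (i', j) \<in> ?E}"
    by (auto simp: inj_on_def double_kite_def)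
  then have "(\<Sum>j | (i, j) \<in> ?E. ?v j) = (\<Sum>j | (i', j) \<in> ?E. ?v (2 * p + L - j))"
    unfolding double_kite_neighbours_reflect[OF i'(2), unfolded i'(3)] by (simp add: sum.reindex)
  also have "\<dots> = (\<Sum>j | (i', j) \<in> ?E. s * ?v j)"
    using kite_vector_reflect[OF assms(5)] by (intro sum.cong) (auto simp: double_kite_def)
  also have "\<dots> = s * ((t + 1 / t) * ?v i')"
    using kite_vector_eigen_left[OF assms(1-4) i'(1)] by (simp flip: sum_distrib_left)
  also have "\<dots> = (t + 1 / t) * ?v i"
    using kite_vector_reflect[OF assms(5) i'(2)] i'(3) by simp
  finally show ?thesis using double_kite_row_sum[OF assms(6)] by simp
qed

text \<open>
  For \<open>L \<rightarrow> \<infinity>\<close> the terms with \<open>s\<close> become negligible, and the equation tends to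
  \<open>(t + 1 / t - (p - 1)) * t = p\<close>. There the left side is \<open>1\<close> at \<open>t = p - 1\<close> and \<open>p + 1\<close> at \<open>t = p\<close>; the
  hypotheses on \<open>p\<close> and \<open>L\<close> leave enough room for the perturbation.
\<close>

lemma kite_equation_root:
  assumes "p \<ge> 3" "L \<ge> 2" "s = 1 \<or> s = -1"
  shows "\<exists>t. real p - 1 \<le> t \<and> t \<le> p \<and> kite_equation p L s t"
proof -
  define h where "h t = (t + 1 / t - (real p - 1)) * (t ^ (L + 1) + s / t) - p * (t ^ L + s)" for t
  define q where "q = real p - 1"
  have q: "q \<ge> 2" "real p = q + 1" using assms(1) by (auto simp: q_def)
  have pow_ge: "x * x \<le> x ^ L" if "x \<ge> 1" for x :: real
    using power_increasing[OF assms(2) that] by (simp add: power2_eq_square)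
  have "h q \<le> 0"
  proof -
    have "h q = - q * q ^ L + s * (1 / (q * q) - q - 1)"
      using q by (simp add: h_def field_simps)
    also have "s * (1 / (q * q) - q - 1) \<le> q + 1"
    proof -
      define r where "r = 1 / (q * q)"
      have "0 \<le> r" "r \<le> 1" using q mult_mono[of 1 q 1 q] by (auto simp: r_def)
      then show ?thesis using assms(3) q unfolding r_def[symmetric] by auto
    qed
    also have "- q * q ^ L + (q + 1) \<le> 0"
    proof -
      have "2 * q \<le> q * q" using q by (intro mult_right_mono) auto
      then have "q + 1 \<le> q * q" using q by linarith
      also have "\<dots> \<le> q ^ L" using pow_ge q by simp
      also have "\<dots> \<le> q * q ^ L" using q by simp
      finally show ?thesis by simp
    qed
    finally show ?thesis by simp
  qed
  moreover have "h p \<ge> 0"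
  proof -
    define x where "x = real p"
    have x: "x \<ge> 3" using assms(1) by (simp add: x_def)
    have "h x = x ^ L + s * ((x + 1) / (x * x) - x)"
      using x by (simp add: h_def x_def[symmetric] field_simps)
    moreover have "s * ((x + 1) / (x * x) - x) \<ge> - x"
    proof -
      define r where "r = (x + 1) / (x * x)"
      have "0 \<le> r" using x by (simp add: r_def)
      moreover have "r \<le> x"
      proof -
        have "3 * x \<le> x * x" using x by (intro mult_right_mono) auto
        then have "x + 1 \<le> x * x" using x by linarith
        also have "\<dots> \<le> x * (x * x)" using x by simp
        finally show ?thesis using x by (simp add: r_def divide_le_eq)
      qed
      ultimately show ?thesis using assms(3) x unfolding r_def[symmetric] by auto
    qed
    moreover have "x \<le> x ^ L" using self_le_power[of x L] x assms(2) by simp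
    ultimately have "0 \<le> h x" by linarith
    then show ?thesis by (simp only: x_def)
  qed
  moreover have "continuous_on {q..p} h"
    unfolding h_def using q by (intro continuous_intros) auto
  ultimately obtain t where "q \<le> t" "t \<le> p" "h t = 0"
    using IVT'[of h q 0 "real p"] q by auto
  then show ?thesis by (auto simp: h_def kite_equation_def q_def)
qed

text \<open>
  For both signs \<open>kite_equation\<close> expresses the eigenvalue as
  \<open>p - 1 + p * (t ^ L + s) / (t ^ (L + 1) + s / t)\<close>, and the fraction differs from \<open>1 / t\<close> by at most
  \<open>1 / t ^ (L + 1)\<close> in the direction of \<open>s\<close>. Since the even parameter \<open>t\<close> is at least the odd
  parameter \<open>u\<close>, the difference \<open>1 / t - 1 / u\<close> of the leading terms only makes the gap smaller, so
  the gap is controlled by the two exponentially small errors.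
\<close>

lemma double_kite_gap:
  assumes p: "p \<ge> 3" and L: "L \<ge> 2"
  shows "min_spectral_gap (2 * p + L + 1) \<le> 2 * p / (real p - 1) ^ (L + 1)"
proof -
  let ?n = "2 * p + L + 1" and ?G = "double_kite p L"
  let ?f = "\<lambda>(i, j). if (i, j) \<in> parcs ?G then 1 else (0 :: real)"
  let ?P = "char_poly (adjacency_matrix ?G)"
  have A: "adjacency_matrix ?G = mat ?n ?n ?f"
    by (rule adjacency_matrix_connected_graph[OF double_kite_connected])
  define q where "q = real p - 1"
  have q: "q \<ge> 2" using p by (simp add: q_def)
  obtain t where t: "q \<le> t" "kite_equation p L 1 t"
    using kite_equation_root[OF p L, of 1] by (auto simp: q_def)
  obtain u where u: "q \<le> u" "kite_equation p L (-1) u"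
    using kite_equation_root[OF p L, of "-1"] by (auto simp: q_def)
  have root: "poly ?P (x + 1 / x) = 0"
    if "q \<le> x" "kite_equation p L s x" "s * s = 1" "kite_vector p L s x p \<noteq> 0" for x s
    unfolding A root_char_poly_mat_iff
  proof (intro exI[of _ "kite_vector p L s x"] conjI allI impI)
    show "\<exists>i<?n. kite_vector p L s x i \<noteq> 0" using that(4) by (intro exI[of _ p]) simp
    fix i assume "i < ?n"
    then show "(\<Sum>j<?n. ?f (i, j) * kite_vector p L s x j) = (x + 1 / x) * kite_vector p L s x i"
      using kite_vector_eigen[of p L x s i] that p L q by simp
  qed
  have pow1: "x ^ L > 1" if "q \<le> x" for x
    using that q L by (intro one_less_power) auto
  have root_t: "poly ?P (t + 1 / t) = 0"
    by (rule root[OF t]) (use pow1[OF t(1)] in \<open>auto simp: kite_vector_def\<close>)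
  have root_u: "poly ?P (u + 1 / u) = 0"
    by (rule root[OF u]) (use pow1[OF u(1)] in \<open>auto simp: kite_vector_def\<close>)
  have max: "x \<le> t + 1 / t" if "poly ?P x = 0" for x
  proof (rule nonneg_matrix_eigenvalue_le[where n = ?n and f = ?f and v = "kite_vector p L 1 t"])
    show "kite_vector p L 1 t i > 0" if "i < ?n" for i
      using t(1) q p by (auto simp: kite_vector_def intro!: divide_pos_pos add_pos_pos)
    show "(\<Sum>j<?n. ?f (i, j) * kite_vector p L 1 t j) = (t + 1 / t) * kite_vector p L 1 t i"
      if "i < ?n" for i
      using kite_vector_eigen[of p L t 1 i] that p L q t by simp
    show "poly (char_poly (mat ?n ?n ?f)) x = 0" using that A by simp
  qed auto
  have diff: "t + 1 / t - (u + 1 / u) = (t - u) * (1 - 1 / (t * u))"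
    using t(1) u(1) q by (simp add: field_simps)
  have tu: "t * u > 1" using mult_mono[of 2 t 2 u] t(1) u(1) q by simp
  \<comment> \<open>The function \<open>x + 1 / x\<close> increases for \<open>x \<ge> 1\<close>, so the order of the eigenvalues, known from
     the positivity of the even eigenvector, is that of the parameters.\<close>
  have "u \<le> t"
  proof (rule ccontr)
    assume "\<not> u \<le> t"
    then have "(t - u) * (1 - 1 / (t * u)) < 0"
      using tu by (intro mult_neg_pos) auto
    then show False using max[OF root_u] diff by simp
  qed
  \<comment> \<open>If one parameter solved both equations, their sum and difference would give
     \<open>d = p * t\<close> and \<open>d * t = p\<close>, which is impossible for \<open>t > 1\<close>.\<close>
  have "t \<noteq> u"
  proof
    assume "t = u"
    define d where "d = t + 1 / t - (real p - 1)"
    have t0: "t > 1" using t(1) q by simp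
    have e1: "d * (t ^ (L + 1) + 1 / t) = p * (t ^ L + 1)"
      and e2: "d * (t ^ (L + 1) - 1 / t) = p * (t ^ L - 1)"
      using t(2) u(2) \<open>t = u\<close> by (simp_all add: kite_equation_def d_def)
    have "d * (1 / t) = p" "d * t ^ (L + 1) = p * t ^ L"
      using e1 e2 unfolding distrib_left right_diff_distrib by linarith+
    then have "d = p * t" "d * t = p" using t0 by (simp_all add: field_simps)
    then have "p * (t * t) = p * 1" by simp
    then have "t * t = 1" using p by simp
    then show False using t0 mult_strict_mono[of 1 t 1 t] by simp
  qed
  with diff tu have ne: "t + 1 / t \<noteq> u + 1 / u" by auto
  have factor_nonneg: "0 \<le> x + 1 / x - q" if "q \<le> x" for x
  proof -
    have "0 \<le> 1 / x" using that q by simp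
    then show ?thesis using that by linarith
  qed
  have upper: "t + 1 / t - q \<le> p * (1 / t + 1 / t ^ (L + 1))"
  proof -
    have "(t + 1 / t - q) * t ^ (L + 1) \<le> (t + 1 / t - q) * (t ^ (L + 1) + 1 / t)"
      using factor_nonneg[OF t(1)] t(1) q by (intro mult_left_mono) auto
    also have "\<dots> = p * (t ^ L + 1)" using t(2) by (simp add: kite_equation_def q_def)
    finally show ?thesis using t(1) q by (simp add: field_simps)
  qed
  have lower: "p * (1 / u - 1 / u ^ (L + 1)) \<le> u + 1 / u - q"
  proof -
    have "p * (u ^ L - 1) = (u + 1 / u - q) * (u ^ (L + 1) - 1 / u)"
      using u(2) by (simp add: kite_equation_def q_def)
    also have "\<dots> \<le> (u + 1 / u - q) * u ^ (L + 1)"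
      using factor_nonneg[OF u(1)] u(1) q by (intro mult_left_mono) auto
    finally show ?thesis using u(1) q by (simp add: field_simps)
  qed
  have inv: "1 / x ^ (L + 1) \<le> 1 / q ^ (L + 1)" if "q \<le> x" for x
    using that q by (intro divide_left_mono power_mono mult_pos_pos zero_less_power) auto
  have "min_spectral_gap ?n \<le> t + 1 / t - (u + 1 / u)"
    using min_spectral_gap_le[OF double_kite_connected]
      spectral_gap_le_difference[OF double_kite_connected root_u max root_t ne]
    by (rule order.trans)
  also have "\<dots> \<le> p * ((1 / t - 1 / u) + (1 / t ^ (L + 1) + 1 / u ^ (L + 1)))"
    using upper lower by (simp add: algebra_simps)
  also have "\<dots> \<le> p * (0 + (1 / q ^ (L + 1) + 1 / q ^ (L + 1)))"
  proof (intro mult_left_mono add_mono inv t(1) u(1))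
    show "1 / t - 1 / u \<le> 0" using \<open>u \<le> t\<close> u(1) q by (simp add: frac_le)
  qed simp
  finally show ?thesis by (simp add: q_def mult.commute)
qed

section \<open>Choosing the clique size\<close>

text \<open>
  Cliques on \<open>q + 2\<close> vertices with \<open>q = \<lfloor>n / ln n\<rfloor>\<close> balance the two effects of the clique size: the
  decay rate per edge grows with it, but the path gets shorter. The constant \<open>10\<close> is generous.
\<close>

lemma min_spectral_gap_upper:
  "\<forall>\<^sub>F n in sequentially. min_spectral_gap n \<le>
     exp (- (real n * ln (real n)) + real n * ln (ln (real n)) + 10 * real n)"
proof -
  have "\<forall>\<^sub>F n in sequentially. real n / ln (real n) \<ge> 4"
    "\<forall>\<^sub>F n in sequentially. 2 * (real n / ln (real n)) + 5 \<le> real n"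
    "\<forall>\<^sub>F n in sequentially. ln (real n) \<ge> 1"
    by real_asymp+
  then show ?thesis
    using eventually_ge_at_top[of 3]
  proof eventually_elim
    case (elim n)
    define y q L where "y = real n / ln (real n)" and "q = nat \<lfloor>y\<rfloor>" and "L = n - 2 * q - 3"
    have y: "y \<ge> 4" "2 * y + 5 \<le> real n" using elim by (simp_all add: y_def)
    have q: "real q \<le> y" "y / 2 \<le> real q" "real q \<ge> 2"
      using y(1) unfolding q_def by linarith+
    have n: "n = 2 * (q + 1) + L + 1" and "L \<ge> 2"
    proof -
      have "real (2 * q + 5) \<le> real n" using q(1) y(2) by simp
      then have "2 * q + 5 \<le> n" by (simp only: of_nat_le_iff)
      then show "n = 2 * (q + 1) + L + 1" "L \<ge> 2" by (auto simp: L_def)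
    qed
    \<comment> \<open>A lower bound for \<open>ln q\<close> that expands into logarithms of \<open>n\<close> exactly; the loss from rounding
       \<open>y\<close> down is absorbed by the factor \<open>1 / 2\<close>, which costs only \<open>n * ln 2\<close>.\<close>
    define m where "m = ln (y / 2)"
    have m: "m = ln (real n) - ln (ln (real n)) - ln 2"
      using elim by (simp add: m_def y_def ln_div ln_mult)
    have "0 \<le> m" using y(1) by (simp add: m_def)
    have "m \<le> ln (real q)" using q y(1) by (simp add: m_def)
    have "min_spectral_gap n \<le> 2 * real (q + 1) / real q ^ (L + 1)"
      using double_kite_gap[of "q + 1" L] q(3) \<open>L \<ge> 2\<close> unfolding n by simp
    also have "\<dots> \<le> (4 * real q) / real q ^ (L + 1)"
      using q(3) by (intro divide_right_mono) auto
    also have "\<dots> = exp (ln 4 - L * ln (real q))"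
      using q(3) by (simp add: exp_diff exp_of_nat_mult)
    also have "\<dots> \<le> exp (- (real n * ln (real n)) + real n * ln (ln (real n)) + 10 * real n)"
    proof (subst exp_le_cancel_iff)
      have "real L * m \<le> L * ln (real q)"
        using \<open>m \<le> ln (real q)\<close> by (intro mult_left_mono) auto
      moreover have "real L = real n - (2 * real q + 3)" using n by simp
      then have "real L * m = real n * m - (2 * real q + 3) * m" by (simp add: left_diff_distrib)
      moreover have "real n * m = real n * ln (real n) - real n * ln (ln (real n)) - real n * ln 2"
        unfolding m by (simp add: right_diff_distrib)
      moreover have "(2 * real q + 3) * m \<le> 2 * real n + 3 * ln (real n)"
      proof -
        have "0 \<le> ln (ln (real n))" "0 \<le> ln (2 :: real)" using elim by simp_all
        then have "m \<le> ln (real n)" using m by linarith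
        then have "(2 * real q + 3) * m \<le> (2 * y + 3) * ln (real n)"
          using q(1) y(1) \<open>0 \<le> m\<close> by (intro mult_mono) auto
        also have "\<dots> = 2 * real n + 3 * ln (real n)"
          using elim by (simp add: y_def field_simps)
        finally show ?thesis .
      qed
      moreover have "real n * ln 2 \<le> real n" using ln_le_minus_one[of 2] by (simp add: mult_left_le)
      moreover have "ln (real n) \<le> real n" using ln_le_minus_one[of "real n"] elim by simp
      moreover have "ln 4 \<le> real n" using ln_le_minus_one[of 4] elim by simp
      ultimately show "ln 4 - L * ln (real q)
          \<le> - (real n * ln (real n)) + real n * ln (ln (real n)) + 10 * real n"
        by linarith
    qed
    finally show ?case .
  qed
qed

theorem lemma4p1:
  shows "(\<exists>f :: nat \<Rightarrow> real. f \<in> O(\<lambda>n. real n) \<and>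
           (\<forall>\<^sub>F n in sequentially. min_spectral_gap n \<le>
              exp (- (real n * ln (real n)) + real n * ln (ln (real n)) + f n)))
       \<and> (\<forall>K :: real. K > 0 \<longrightarrow> min_spectral_gap \<in> o(\<lambda>n. real n powr (- K)))"
proof (intro conjI allI impI)
  show "\<exists>f :: nat \<Rightarrow> real. f \<in> O(\<lambda>n. real n) \<and>
           (\<forall>\<^sub>F n in sequentially. min_spectral_gap n \<le>
              exp (- (real n * ln (real n)) + real n * ln (ln (real n)) + f n))"
    by (rule exI[of _ "\<lambda>n. 10 * real n"]) (use min_spectral_gap_upper in simp)
next
  fix K :: real assume "K > 0"
  let ?g = "\<lambda>n. exp (- (real n * ln (real n)) + real n * ln (ln (real n)) + 10 * real n)"
  have "min_spectral_gap \<in> O(?g)"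
  proof (rule landau_o.bigI[of 1])
    show "\<forall>\<^sub>F n in sequentially. norm (min_spectral_gap n) \<le> 1 * norm (?g n)"
      using min_spectral_gap_upper eventually_ge_at_top[of 2]
      by eventually_elim (simp add: min_spectral_gap_nonneg)
  qed simp
  also have "?g \<in> o(\<lambda>n. real n powr (- K))"
    by real_asymp
  finally show "min_spectral_gap \<in> o(\<lambda>n. real n powr (- K))" .
qed

end
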